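(* Let $a$ and $b$ be positive integers with $a\ge 2$, and consider the Pell equation $x^{2}-(a^{2}b^{2}-b)y^{2}=1$. Then the following hold. (i) The continued fraction expansion of $\sqrt{a^{2}b^{2}-b}$ is $$\sqrt{a^{2}b^{2}-b}=\begin{cases}[a-1;\overline{1,2a-2}] & \text{if } b=1,\\ [ab-1;\overline{1,2a-2,1,2ab-2}] & \text{if } b>1.\end{cases}$$ (ii) The fundamental solution of the equation is $$(x_{1},y_{1})=\begin{cases}(a,1) & \text{if } b=1,\\ (2a^{2}b-1,2a) & \text{if } b>1.\end{cases}$$ (iii) The $n$-th solution $(x_{n},y_{n})$ of the equation can be found by $$\frac{x_{n}}{y_{n}}=\begin{cases}[a-1;(1,2a-2)_{n-1},1] & \text{if } b=1,\\ [ab-1;(1,2a-2,1,2ab-2)_{n-1},1] & \text{if } b>1.\end{cases}$$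
   Context: $[a_0;a_1,a_2,\dots]$ denotes the simple continued fraction $a_0+\cfrac{1}{a_1+\cfrac{1}{a_2+\cdots}}$ (finite or infinite), and an overline marks the block of partial quotients that repeats periodically. The notation $(1,2a-2)_{n-1}$, respectively $(1,2a-2,1,2ab-2)_{n-1}$, inside a continued fraction means that there are $n-1$ successive blocks $1,2a-2$, respectively $1,2a-2,1,2ab-2$. For a positive non-square integer $d$, the fundamental solution $(x_1,y_1)$ of $x^2-dy^2=1$ is its smallest solution in positive integers, and the $n$-th solution $(x_n,y_n)$, $n\ge 1$, is given by $x_n+y_n\sqrt d=(x_1+y_1\sqrt d)^n$.
   Formalization: In (iii) with b>1 the printed final entry 1 is replaced by 1,2a-2,1, so x_n/y_n=[ab-1;(1,2a-2,1,2ab-2)_{n-1},1,2a-2,1]; the printed formula is false (at n=1 it gives ab, but x_1/y_1=ab-1/(2a)). *)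

theory Defs
  imports Complex_Main
begin

(* cfrac_fin a0 [a1, ..., ak] is [a0; a1, ..., ak]. *)
fun cfrac_fin :: "int \<Rightarrow> int list \<Rightarrow> real" where
  "cfrac_fin a [] = real_of_int a"
| "cfrac_fin a (c # cs) = real_of_int a + 1 / cfrac_fin c cs"

(* x = [q 0; q 1, q 2, ...] as an infinite simple continued fraction: the partial
   quotients after the first are positive, and the value is the limit of the
   truncations [q 0; q 1, ..., q k]. *)
definition has_cfrac :: "real \<Rightarrow> (nat \<Rightarrow> int) \<Rightarrow> bool" where
  "has_cfrac x q \<longleftrightarrow> (\<forall>i\<ge>1. q i \<ge> 1) \<and>
     (\<lambda>k. cfrac_fin (q 0) (map q [1..<Suc k])) \<longlonglongrightarrow> x"

(* The partial quotients a0, c1, ..., cm, c1, ..., cm, ... where cs = [c1, ..., cm]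
   is the (nonempty) block under the overline. *)
definition periodic_quotients :: "int \<Rightarrow> int list \<Rightarrow> nat \<Rightarrow> int" where
  "periodic_quotients a cs i = (if i = 0 then a else cs ! ((i - 1) mod length cs))"

definition pell_positive_solution :: "int \<Rightarrow> int \<Rightarrow> int \<Rightarrow> bool" where
  "pell_positive_solution d x y \<longleftrightarrow> x > 0 \<and> y > 0 \<and> x\<^sup>2 - d * y\<^sup>2 = 1"

(* Among positive solutions of one equation x and y increase together, so "smallest"
   can be taken in both coordinates at once. *)
definition pell_fundamental :: "int \<Rightarrow> int \<Rightarrow> int \<Rightarrow> bool" where
  "pell_fundamental d x y \<longleftrightarrow> d > 0 \<and> (\<nexists>k::int. d = k\<^sup>2) \<and>
     pell_positive_solution d x y \<and>
     (\<forall>u v. pell_positive_solution d u v \<longrightarrow> x \<le> u \<and> y \<le> v)"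

(* Since d is not a square, the integers x and y are determined by x + y * sqrt d. *)
definition pell_nth_solution :: "int \<Rightarrow> nat \<Rightarrow> int \<Rightarrow> int \<Rightarrow> bool" where
  "pell_nth_solution d n x y \<longleftrightarrow> (\<exists>x1 y1. pell_fundamental d x1 y1 \<and>
     real_of_int x + real_of_int y * sqrt (real_of_int d) =
       (real_of_int x1 + real_of_int y1 * sqrt (real_of_int d)) ^ n)"

end

(* Each part reduces to a short identity for the period. A real number whose complete quotients
   are periodic has the corresponding periodic expansion, since two consecutive complete
   quotients have product at least 2 and so two further partial quotients at least halve the
   error. For the fundamental solution with b > 1, writing x = a b y - k turns the equation into
   b y (2 a k - y) = k^2 - 1, and y < 2 a forces k = 1. Finally, prepending one period to a finite
   continued fraction acts on its value r as r \<mapsto> (x1 r + d y1) / (x1 + y1 r), which is exactly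
   multiplication by x1 + y1 sqrt d. *)
theory Submission
  imports Defs
begin

section \<open>Continued fractions from complete quotients\<close>

text \<open>Serves to compare a tail that starts in the last quotient of a period with a shorter
  fraction of the same shape: since \<open>2*a - 2 = (a - 1) + (a - 1)\<close>, and likewise with
  \<open>a*b\<close> for \<open>a\<close>, the two differ by an integer.\<close>

lemma cfrac_fin_add_left: "cfrac_fin (c + e) cs = real_of_int c + cfrac_fin e cs"
  by (cases cs) auto

lemma cfrac_fin_ge_1:
  assumes "c \<ge> 1" "\<And>e. e \<in> set cs \<Longrightarrow> e \<ge> 1"
  shows "cfrac_fin c cs \<ge> 1"
  using assms
proof (induction cs arbitrary: c)
  case (Cons e cs)
  have "cfrac_fin e cs \<ge> 1"
    using Cons.prems by (intro Cons.IH) auto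
  then have "1 / cfrac_fin e cs \<ge> 0" by simp
  moreover have "real_of_int c \<ge> 1" using Cons.prems by simp
  ultimately show ?case unfolding cfrac_fin.simps by linarith
qed auto

text \<open>Peeling off one quotient divides the error by the product of the next complete quotient
  and the next truncated value, both at least 1. Over two quotients these divisors multiply to at
  least 2, hence the exponent \<open>m div 2\<close> and an induction in steps of two.\<close>

lemma cfrac_fin_error:
  fixes t :: "nat \<Rightarrow> real"
  assumes q: "\<And>i. i \<ge> 1 \<Longrightarrow> q i \<ge> 1"
    and t: "\<And>i. t i = real_of_int (q i) + 1 / t (Suc i)"
    and pos: "\<And>i. i \<ge> 1 \<Longrightarrow> t i > 0"
  shows "\<bar>t i - cfrac_fin (q i) (map q [Suc i..<Suc (i + m)])\<bar> \<le> (1 / 2) ^ (m div 2)"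
proof (induction m arbitrary: i rule: less_induct)
  case (less m)
  define C where "C i m = cfrac_fin (q i) (map q [Suc i..<Suc (i + m)])" for i m
  have t1: "t j \<ge> 1" if "j \<ge> 1" for j
  proof -
    have "1 / t (Suc j) > 0" using pos[of "Suc j"] by simp
    moreover have "real_of_int (q j) \<ge> 1" using q[OF that] by simp
    ultimately show ?thesis using t[of j] by linarith
  qed
  have C1: "C j m \<ge> 1" if "j \<ge> 1" for j m
    unfolding C_def using that by (intro cfrac_fin_ge_1) (auto intro!: q)
  have Crec: "C j (Suc m) = real_of_int (q j) + 1 / C (Suc j) m" for j m
    unfolding C_def by (subst upt_conv_Cons) (simp_all del: upt_Suc)
  have step: "\<bar>t j - C j (Suc m)\<bar> = \<bar>t (Suc j) - C (Suc j) m\<bar> / (t (Suc j) * C (Suc j) m)"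
    for j m
  proof -
    have "t (Suc j) \<ge> 1" "C (Suc j) m \<ge> 1" using t1 C1 by simp_all
    then have "t j - C j (Suc m) = (C (Suc j) m - t (Suc j)) / (t (Suc j) * C (Suc j) m)"
      unfolding t[of j] Crec by (simp add: field_simps)
    moreover have "t (Suc j) * C (Suc j) m > 0"
      using \<open>t (Suc j) \<ge> 1\<close> \<open>C (Suc j) m \<ge> 1\<close> by (intro mult_pos_pos) auto
    ultimately show ?thesis by (simp add: abs_minus_commute)
  qed
  \<comment> \<open>With no further quotients the error is exactly
    \<open>1 / t (Suc j)\<close>.\<close>
  have base: "\<bar>t j - C j 0\<bar> \<le> 1" for j
    using t1[of "Suc j"] t[of j] by (simp add: C_def)
  consider "m = 0" | "m = 1" | k where "m = Suc (Suc k)"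
    by (metis One_nat_def not0_implies_Suc)
  then have "\<bar>t i - C i m\<bar> \<le> (1 / 2) ^ (m div 2)"
  proof cases
    case 1
    then show ?thesis using base[of i] by simp
  next
    case 2
    have "t (Suc i) * C (Suc i) 0 \<ge> 1"
      using mult_mono[OF t1[of "Suc i"] C1[of "Suc i" 0]] t1[of "Suc i"] by simp
    then have "\<bar>t i - C i (Suc 0)\<bar> \<le> 1"
      unfolding step using base[of "Suc i"] by (simp add: divide_le_eq)
    then show ?thesis using 2 by simp
  next
    case 3
    let ?t1 = "t (Suc i)" and ?t2 = "t (Suc (Suc i))"
    let ?C1 = "C (Suc i) (Suc k)" and ?C2 = "C (Suc (Suc i)) k"
    have ge: "?t1 \<ge> 1" "?t2 \<ge> 1" "?C1 \<ge> 1" "?C2 \<ge> 1"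
      using t1 C1 by simp_all
    \<comment> \<open>The factor 2 arises here: multiplying the recurrence for \<open>?t1\<close> by
      \<open>?t2\<close> gives a product at least 1, plus 1.\<close>
    have "?t1 * ?t2 = real_of_int (q (Suc i)) * ?t2 + 1"
      using ge unfolding t[of "Suc i"] by (simp add: field_simps)
    moreover have "real_of_int (q (Suc i)) * ?t2 \<ge> 1 * 1"
      using ge q[of "Suc i"] by (intro mult_mono) auto
    ultimately have tt: "?t1 * ?t2 \<ge> 2" by simp
    have CC: "?C1 * ?C2 \<ge> 1"
      using mult_mono[of 1 ?C1 1 ?C2] ge by simp
    have "2 * 1 \<le> (?t1 * ?t2) * (?C1 * ?C2)"
      using tt CC by (intro mult_mono) auto
    then have den: "2 \<le> (?t2 * ?C2) * (?t1 * ?C1)" by (simp add: mult_ac)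
    have "\<bar>t i - C i (Suc (Suc k))\<bar> = \<bar>?t2 - ?C2\<bar> / ((?t2 * ?C2) * (?t1 * ?C1))"
      by (simp only: step divide_divide_eq_left)
    also have "\<dots> \<le> \<bar>?t2 - ?C2\<bar> / 2"
      using den by (intro divide_left_mono) auto
    also have "\<dots> \<le> (1 / 2) ^ (k div 2) / 2"
      using less.IH[of k "Suc (Suc i)", folded C_def] 3 by (intro divide_right_mono) auto
    finally show ?thesis unfolding 3 by simp
  qed
  then show ?case unfolding C_def .
qed

lemma has_cfrac_of_complete_quotients:
  fixes t :: "nat \<Rightarrow> real"
  assumes q: "\<And>i. i \<ge> 1 \<Longrightarrow> q i \<ge> 1"
    and t: "\<And>i. t i = real_of_int (q i) + 1 / t (Suc i)"
    and pos: "\<And>i. i \<ge> 1 \<Longrightarrow> t i > 0"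
  shows "has_cfrac (t 0) q"
proof -
  have "filterlim (\<lambda>m::nat. m div 2) sequentially sequentially"
    by (rule filterlim_at_top_div_const_nat) simp
  then have "(\<lambda>m. (1 / 2 :: real) ^ (m div 2)) \<longlonglongrightarrow> 0"
    by (intro filterlim_compose[OF LIMSEQ_realpow_zero]) auto
  then have "(\<lambda>m. cfrac_fin (q 0) (map q [1..<Suc m])) \<longlonglongrightarrow> t 0"
  proof (rule metric_tendsto_imp_tendsto)
    show "\<forall>\<^sub>F m in sequentially.
        dist (cfrac_fin (q 0) (map q [1..<Suc m])) (t 0) \<le> dist ((1 / 2) ^ (m div 2)) (0 :: real)"
      using cfrac_fin_error[of q t 0, OF q t pos]
      by (intro always_eventually allI) (simp add: dist_real_def abs_minus_commute del: upt_Suc)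
  qed
  then show ?thesis
    using q by (simp add: has_cfrac_def del: upt_Suc)
qed

text \<open>\<open>ts\<close> lists the complete quotients of one period. Because \<open>rec\<close>
  closes up cyclically, finitely many identities suffice to establish the infinite
  expansion.\<close>

lemma has_cfrac_periodic:
  fixes ts :: "real list"
  assumes len: "length ts = length cs" "cs \<noteq> []"
    and cs: "\<And>c. c \<in> set cs \<Longrightarrow> c \<ge> 1"
    and ts: "\<And>r. r \<in> set ts \<Longrightarrow> r > 0"
    and rec: "\<And>j. j < length cs \<Longrightarrow>
      ts ! j = real_of_int (cs ! j) + 1 / ts ! (Suc j mod length cs)"
  shows "has_cfrac (real_of_int a + 1 / ts ! 0) (periodic_quotients a cs)"
proof -
  let ?t = "\<lambda>i. if i = 0 then real_of_int a + 1 / ts ! 0 else ts ! ((i - 1) mod length cs)"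
  have "has_cfrac (?t 0) (periodic_quotients a cs)"
  proof (rule has_cfrac_of_complete_quotients[where t = ?t])
    fix i
    show "?t i = real_of_int (periodic_quotients a cs i) + 1 / ?t (Suc i)"
    proof (cases i)
      case (Suc j)
      then show ?thesis
        using rec[of "j mod length cs"] len
        by (simp add: periodic_quotients_def mod_Suc_eq)
    qed (use len in \<open>simp add: periodic_quotients_def\<close>)
  qed (use len cs ts in \<open>auto simp: periodic_quotients_def\<close>)
  then show ?thesis by simp
qed

section \<open>Solutions of the Pell equation\<close>

text \<open>If \<open>v\<close> and \<open>y\<close> differed, squaring
  \<open>x - u = (v - y) * sqrt d\<close> would make \<open>v - y\<close> a divisor of
  \<open>x - u\<close>, and \<open>d\<close> the square of the quotient.\<close>

lemma int_add_mult_sqrt_eq_iff: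
  fixes d x y u v :: int
  assumes "d > 0" and nsq: "\<nexists>k::int. d = k\<^sup>2"
  shows "real_of_int x + real_of_int y * sqrt (real_of_int d) =
      real_of_int u + real_of_int v * sqrt (real_of_int d) \<longleftrightarrow> x = u \<and> y = v"
proof
  assume eq: "real_of_int x + real_of_int y * sqrt (real_of_int d) =
      real_of_int u + real_of_int v * sqrt (real_of_int d)"
  then have "real_of_int (x - u) = real_of_int (v - y) * sqrt (real_of_int d)"
    by (simp add: algebra_simps)
  then have "(real_of_int (x - u))\<^sup>2 = (real_of_int (v - y))\<^sup>2 * real_of_int d"
    using \<open>d > 0\<close> by (simp add: power_mult_distrib)
  then have "real_of_int ((x - u)\<^sup>2) = real_of_int ((v - y)\<^sup>2 * d)"
    by simp
  then have sq: "(x - u)\<^sup>2 = (v - y)\<^sup>2 * d"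
    by (simp only: of_int_eq_iff)
  have "v = y"
  proof (rule ccontr)
    assume "v \<noteq> y"
    have "(v - y)\<^sup>2 dvd (x - u)\<^sup>2" unfolding sq by simp
    then have "v - y dvd x - u" by simp
    then obtain k where "x - u = (v - y) * k" by (elim dvdE)
    then have "d = k\<^sup>2" using sq \<open>v \<noteq> y\<close> by (simp add: power_mult_distrib)
    then show False using nsq by blast
  qed
  then show "x = u \<and> y = v" using eq by simp
qed simp

lemma pell_fundamental_unique:
  assumes "pell_fundamental d x y" "pell_fundamental d u v"
  shows "x = u \<and> y = v"
  using assms unfolding pell_fundamental_def by (meson order_antisym)

text \<open>\<open>R\<close> stands for the values of the continued fractions. The recurrence is the
  action of multiplication by \<open>x1 + y1 * sqrt d\<close> on the ratio \<open>x / y\<close>, so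
  it only has to be checked for each family of fractions.\<close>

lemma pell_nth_solution_ratio:
  fixes R :: "nat \<Rightarrow> real" and d x1 y1 :: int
  assumes fund: "pell_fundamental d x1 y1"
    and R1: "R 1 = real_of_int x1 / real_of_int y1"
    and R_Suc: "\<And>n. n \<ge> 1 \<Longrightarrow> R n > 0 \<Longrightarrow> R (Suc n) =
      (real_of_int x1 * R n + real_of_int (d * y1)) / (real_of_int x1 + real_of_int y1 * R n)"
    and n: "n \<ge> 1"
  shows "(\<exists>x y. pell_nth_solution d n x y) \<and>
    (\<forall>x y. pell_nth_solution d n x y \<longrightarrow> real_of_int x / real_of_int y = R n)"
proof -
  let ?s = "sqrt (real_of_int d)"
  have d: "d > 0" "\<nexists>k::int. d = k\<^sup>2" and pos: "x1 > 0" "y1 > 0"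
    using fund by (auto simp: pell_fundamental_def pell_positive_solution_def)
  \<comment> \<open>Positivity is carried through the induction: it allows division by
    \<open>y\<close> and supplies the premise \<open>R n > 0\<close> of the recurrence.\<close>
  have "\<exists>x y. x > 0 \<and> y > 0 \<and>
      real_of_int x + real_of_int y * ?s = (real_of_int x1 + real_of_int y1 * ?s) ^ n \<and>
      real_of_int x / real_of_int y = R n"
    using n
  proof (induction n rule: nat_induct_at_least)
    case base
    then show ?case using pos R1 by (intro exI[of _ x1] exI[of _ y1]) simp
  next
    case (Suc n)
    then obtain x y :: int where xy: "x > 0" "y > 0"
        "real_of_int x + real_of_int y * ?s = (real_of_int x1 + real_of_int y1 * ?s) ^ n"
        "R n = real_of_int x / real_of_int y" by metis
    let ?x = "x1 * x + d * y1 * y" and ?y = "x1 * y + y1 * x"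
    have "?x > 0" "?y > 0" using xy pos d by (simp_all add: add_pos_pos)
    have ss: "?s * ?s = real_of_int d" using d by simp
    have "(real_of_int x1 + real_of_int y1 * ?s) ^ Suc n =
        (real_of_int x1 + real_of_int y1 * ?s) * (real_of_int x + real_of_int y * ?s)"
      by (simp add: xy)
    also have "\<dots> = real_of_int (x1 * x) + real_of_int (y1 * y) * (?s * ?s)
        + real_of_int ?y * ?s"
      by (simp add: algebra_simps)
    also have "\<dots> = real_of_int ?x + real_of_int ?y * ?s"
      unfolding ss by (simp add: algebra_simps)
    finally have "real_of_int ?x + real_of_int ?y * ?s =
        (real_of_int x1 + real_of_int y1 * ?s) ^ Suc n" by simp
    moreover have "real_of_int ?x / real_of_int ?y = R (Suc n)"
    proof -
      have "R n > 0" using xy by simp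
      have "R (Suc n) = (real_of_int y * (real_of_int x1 * R n + real_of_int (d * y1))) /
          (real_of_int y * (real_of_int x1 + real_of_int y1 * R n))"
        using R_Suc[OF Suc.hyps \<open>R n > 0\<close>] xy by simp
      also have "\<dots> = real_of_int ?x / real_of_int ?y"
        using xy by (simp add: algebra_simps)
      finally show ?thesis by simp
    qed
    ultimately show ?case using \<open>?x > 0\<close> \<open>?y > 0\<close> by blast
  qed
  then obtain x y :: int where xy:
      "real_of_int x + real_of_int y * ?s = (real_of_int x1 + real_of_int y1 * ?s) ^ n"
      "real_of_int x / real_of_int y = R n" by blast
  have "u = x \<and> v = y" if "pell_nth_solution d n u v" for u v
  proof -
    obtain u1 v1 where "pell_fundamental d u1 v1"
        "real_of_int u + real_of_int v * ?s = (real_of_int u1 + real_of_int v1 * ?s) ^ n"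
      using \<open>pell_nth_solution d n u v\<close> unfolding pell_nth_solution_def by blast
    then have "real_of_int u + real_of_int v * ?s = real_of_int x + real_of_int y * ?s"
      using pell_fundamental_unique[OF fund] xy(1) by auto
    then show ?thesis by (simp only: int_add_mult_sqrt_eq_iff[OF d])
  qed
  moreover have "pell_nth_solution d n x y"
    unfolding pell_nth_solution_def using fund xy(1) by blast
  ultimately show ?thesis using xy(2) by blast
qed

section \<open>The case $d = a^2 b^2 - b$\<close>

locale pell_parameters =
  fixes a b d :: int
  assumes a: "a \<ge> 2" and b: "b \<ge> 1" and d: "d = a\<^sup>2 * b\<^sup>2 - b"
begin

section \<open>Size of \<open>d\<close> and its position between consecutive squares\<close>

lemma ab_bounds: "a * b \<ge> 2 * b" "2 * (a * b) > b + 1"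
proof -
  show "a * b \<ge> 2 * b" using a b by (intro mult_right_mono) auto
  then show "2 * (a * b) > b + 1" using b by linarith
qed

text \<open>The gaps below \<open>d\<close> are \<open>2*a*b - b - 1\<close> and
  \<open>b * (2*a*b - b - 1)\<close>; the gap above is \<open>b\<close>.\<close>

lemma d_between: "(a * b - 1)\<^sup>2 < d" "(a * b - b)\<^sup>2 < d" "d < (a * b)\<^sup>2"
proof -
  show "(a * b - 1)\<^sup>2 < d"
    using ab_bounds by (simp add: d power2_eq_square algebra_simps)
  have "b * (2 * (a * b)) > b * (b + 1)" using ab_bounds b by (intro mult_strict_left_mono) auto
  then show "(a * b - b)\<^sup>2 < d" by (simp add: d power2_eq_square algebra_simps)
  show "d < (a * b)\<^sup>2" using b by (simp add: d power2_eq_square algebra_simps)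
qed

lemma d_pos: "d > 0"
  using d_between(1) by (meson le_less_trans zero_le_power2)

lemma d_not_square: "\<nexists>k::int. d = k\<^sup>2"
proof
  assume "\<exists>k::int. d = k\<^sup>2"
  then obtain k where "d = \<bar>k\<bar>\<^sup>2" by auto
  with d_between have "a * b - 1 < \<bar>k\<bar>" "\<bar>k\<bar> < a * b"
    using ab_bounds b by (auto intro: power2_less_imp_less)
  then show False by simp
qed

section \<open>Fundamental solutions\<close>

lemma pell_fundamentalI:
  assumes "pell_positive_solution d x y"
    and "\<And>u v. pell_positive_solution d u v \<Longrightarrow> y \<le> v"
  shows "pell_fundamental d x y"
proof -
  have "x \<le> u" if "pell_positive_solution d u v" for u v
  proof -
    have uv: "y \<le> v" "0 < y" "0 < u" "u\<^sup>2 - d * v\<^sup>2 = 1" "x\<^sup>2 - d * y\<^sup>2 = 1"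
      using that assms by (auto simp: pell_positive_solution_def)
    \<comment> \<open>Minimality passes from \<open>y\<close> to \<open>x\<close> because x^2 = 1 +
      d y^2 increases with y.\<close>
    then have "d * y\<^sup>2 \<le> d * v\<^sup>2"
      using d_pos by (intro mult_left_mono power_mono) auto
    then have "x\<^sup>2 \<le> u\<^sup>2" using uv by linarith
    then show "x \<le> u" using \<open>0 < u\<close> by (auto intro: power2_le_imp_le)
  qed
  then show ?thesis using assms d_pos d_not_square by (auto simp: pell_fundamental_def)
qed

lemma pell_fundamental_eq_1:
  assumes "b = 1"
  shows "pell_fundamental d a 1"
  by (rule pell_fundamentalI) (use a d assms in \<open>auto simp: pell_positive_solution_def\<close>)

lemma pell_fundamental_gt_1:
  assumes b1: "b > 1"
  shows "pell_fundamental d (2 * a\<^sup>2 * b - 1) (2 * a)"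
proof (rule pell_fundamentalI)
  have "1 * 1 \<le> a\<^sup>2 * b" using a b by (intro mult_mono) auto
  then show "pell_positive_solution d (2 * a\<^sup>2 * b - 1) (2 * a)"
    using a by (auto simp: pell_positive_solution_def d power2_eq_square algebra_simps)
next
  fix u v assume "pell_positive_solution d u v"
  then have uv: "u > 0" "v > 0" "u\<^sup>2 = d * v\<^sup>2 + 1"
    by (auto simp: pell_positive_solution_def)
  show "2 * a \<le> v"
  proof (rule ccontr)
    assume "\<not> 2 * a \<le> v"
    then have v: "v < 2 * a" by simp
    define k where "k = a * b * v - u"
    \<comment> \<open>This is where \<open>b > 1\<close> enters: u^2 = (abv)^2 - (b v^2 - 1) is then
      strictly below (abv)^2. For \<open>b = 1\<close> and \<open>v = 1\<close> there is equality,
      which is the solution \<open>(a, 1)\<close>.\<close>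
    have "2 * 1 \<le> b * v\<^sup>2" using b1 uv by (intro mult_mono) auto
    then have "u\<^sup>2 < (a * b * v)\<^sup>2"
      unfolding uv d by (simp add: power_mult_distrib algebra_simps)
    then have "k > 0"
      unfolding k_def using a b uv power2_less_imp_less[of u "a * b * v"] by simp
    have k_le: "k \<le> a * b * v" unfolding k_def using uv by simp
    have u: "u = a * b * v - k" by (simp add: k_def)
    have eq: "2 * (a * b * v) * k - k * k = b * v * v - 1"
      using uv(3) unfolding u d by (simp add: power2_eq_square algebra_simps)
    \<comment> \<open>Bounding \<open>k * k\<close> by \<open>a*b*v*k\<close> leaves at least
      \<open>a*b*v*k\<close> on the left of \<open>eq\<close>, so
      \<open>a * k < v < 2 * a\<close>.\<close>
    have "k * k \<le> (a * b * v) * k" using k_le \<open>k > 0\<close> by (intro mult_right_mono) auto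
    then have "(b * v) * (a * k) < (b * v) * v" using eq by (simp add: mult_ac)
    then have "a * k < v" using b uv by (simp add: mult_less_cancel_left_pos)
    then have "a * k < a * 2" using v by simp
    then have "k < 2" using a by (simp add: mult_less_cancel_left_pos)
    then have "k = 1" using \<open>k > 0\<close> by simp
    \<comment> \<open>For \<open>k = 1\<close> the equation forces \<open>v = 2 * a\<close>, the
      claimed solution itself, which was excluded.\<close>
    then have "(b * v) * (2 * a) = (b * v) * v" using eq by (simp add: mult_ac)
    then show False using v b uv by simp
  qed
qed

section \<open>Periodic expansions of the square root\<close>

lemma sqrt_d_bounds:
  "sqrt (real_of_int d) > real_of_int (a * b) - 1"
  "sqrt (real_of_int d) > real_of_int (a * b) - real_of_int b"
proof -
  have "real_of_int ((a * b - 1)\<^sup>2) < real_of_int d" "real_of_int ((a * b - b)\<^sup>2) < real_of_int d"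
    using d_between by (simp_all only: of_int_less_iff)
  then show "sqrt (real_of_int d) > real_of_int (a * b) - 1"
    "sqrt (real_of_int d) > real_of_int (a * b) - real_of_int b"
    by (auto intro!: real_less_rsqrt)
qed

lemma cfrac_eq_1:
  assumes "b = 1"
  shows "has_cfrac (sqrt (real_of_int d)) (periodic_quotients (a - 1) [1, 2 * a - 2])"
proof -
  define s A where "s = sqrt (real_of_int d)" and "A = real_of_int a"
  have A: "A \<ge> 2" using a by (simp add: A_def)
  have "s * s = real_of_int d" using d_pos by (simp add: s_def)
  then have ss: "s * s = A * A - 1"
    by (simp add: d assms A_def power2_eq_square)
  have s: "s > A - 1" using sqrt_d_bounds(1) assms by (simp add: s_def A_def)
  \<comment> \<open>The first entry is \<open>1 / (s - (A - 1))\<close> rationalized, using s^2 - (A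
    - 1)^2 = 2A - 2. Subtracting 1 and inverting gives the second.\<close>
  let ?ts = "[(s + A - 1) / (2 * A - 2), s + A - 1]"
  have "has_cfrac (real_of_int (a - 1) + 1 / ?ts ! 0) (periodic_quotients (a - 1) [1, 2 * a - 2])"
  proof (rule has_cfrac_periodic)
    fix j assume "j < length [1, 2 * a - 2]"
    then consider "j = 0" | "j = 1" by fastforce
    then show "?ts ! j = real_of_int ([1, 2 * a - 2] ! j)
        + 1 / ?ts ! (Suc j mod length [1, 2 * a - 2])"
      by cases (use A s ss in \<open>simp_all add: A_def[symmetric] field_simps\<close>)
  qed (use A s a in \<open>auto\<close>)
  moreover have "real_of_int (a - 1) + 1 / ?ts ! 0 = s"
    using A s ss by (simp add: A_def[symmetric] field_simps)
  ultimately show ?thesis by (simp only: s_def)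
qed

text \<open>For \<open>b = 1\<close> the block is the period \<open>1, 2*a - 2\<close> written
  twice, so the same four complete quotients cover every \<open>b\<close>.\<close>

lemma cfrac_general:
  "has_cfrac (sqrt (real_of_int d))
    (periodic_quotients (a * b - 1) [1, 2 * a - 2, 1, 2 * a * b - 2])"
proof -
  define s A B where "s = sqrt (real_of_int d)" and "A = real_of_int a" and "B = real_of_int b"
  have A: "A \<ge> 2" and B: "B \<ge> 1" using a b by (simp_all add: A_def B_def)
  have "s * s = real_of_int d" using d_pos by (simp add: s_def)
  then have ss: "s * s = A * A * B * B - B"
    by (simp add: d A_def B_def power2_eq_square)
  have s: "s > A * B - 1" "s > A * B - B" using sqrt_d_bounds by (simp_all add: s_def A_def B_def)
  have AB: "A * B \<ge> 2 * B" using A B by (intro mult_right_mono) auto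
  \<comment> \<open>\<open>D\<close> is s^2 - (AB - 1)^2, the denominator produced by rationalizing
    \<open>1 / (s - (A * B - 1))\<close>.\<close>
  define D where "D = 2 * A * B - 1 - B"
  have D: "D > 0" using AB B unfolding D_def mult.assoc by linarith
  let ?cs = "[1, 2 * a - 2, 1, 2 * a * b - 2]"
  \<comment> \<open>Found by alternately removing the integer part and rationalizing the reciprocal;
    \<open>p1\<close> and \<open>p2\<close> are the two rationalizations that occur.\<close>
  let ?ts = "[(s + A * B - 1) / D, (s + A * B - B) / B, (s + A * B - B) / D, s + A * B - 1]"
  have p1: "(s + A * B - 1) * (s - A * B + 1) = D" and
    p2: "(s + A * B - B) * (s - A * B + B) = B * D"
    using ss by (simp_all add: D_def algebra_simps)
  have pos: "s + A * B - 1 > 0" "s + A * B - B > 0" using s AB B by linarith+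
  have i1: "1 / (s + A * B - 1) = (s - A * B + 1) / D"
    using p1 pos D by (simp add: field_simps)
  have i2: "1 / (s + A * B - B) = (s - A * B + B) / (B * D)"
    using p2 pos D B by (simp add: field_simps)
  have shift: "1 + r / D = (D + r) / D" for r
    using D by (simp add: add_divide_distrib)
  have "has_cfrac (real_of_int (a * b - 1) + 1 / ?ts ! 0) (periodic_quotients (a * b - 1) ?cs)"
  proof (rule has_cfrac_periodic)
    fix c assume "c \<in> set ?cs"
    then show "c \<ge> 1" using a b ab_bounds by auto
  next
    fix j assume "j < length ?cs"
    then consider "j = 0" | "j = 1" | "j = 2" | "j = 3" by fastforce
    then show "?ts ! j = real_of_int (?cs ! j) + 1 / ?ts ! (Suc j mod length ?cs)"
    proof cases
      case 1
      have "B * (1 / (s + A * B - B)) = (s - A * B + B) / D"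
        unfolding i2 using B by simp
      moreover have "D + (s - A * B + B) = s + A * B - 1" by (simp add: D_def)
      ultimately have "1 + B * (1 / (s + A * B - B)) = (s + A * B - 1) / D"
        by (simp only: shift)
      with 1 show ?thesis by simp
    next
      case 2
      have "2 * A - 2 + D * (1 / (s + A * B - B)) = (s + A * B - B) / B"
      proof -
        have "D * (1 / (s + A * B - B)) = (s - A * B + B) / B"
          unfolding i2 using D by simp
        then show ?thesis using B by (simp add: field_simps)
      qed
      with 2 show ?thesis by (simp add: A_def)
    next
      case 3
      have "1 + 1 / (s + A * B - 1) = (s + A * B - B) / D"
      proof -
        have "D + (s - A * B + 1) = s + A * B - B" by (simp add: D_def)
        then show ?thesis by (simp only: i1 shift)
      qed
      with 3 show ?thesis by simp
    next
      case 4
      have "2 * A * B - 2 + D * (1 / (s + A * B - 1)) = s + A * B - 1"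
        unfolding i1 using D B by (simp add: field_simps)
      with 4 show ?thesis by (simp add: A_def B_def)
    qed
  qed (use pos D B in \<open>auto\<close>)
  moreover have "real_of_int (a * b - 1) + 1 / ?ts ! 0 = s"
  proof -
    have "A * B - 1 + D * (1 / (s + A * B - 1)) = s"
      unfolding i1 using D by (simp add: field_simps)
    then show ?thesis by (simp add: A_def B_def)
  qed
  ultimately show ?thesis by (simp only: s_def)
qed

section \<open>Ratios of the n-th solutions as finite continued fractions\<close>

lemma pell_nth_ratio_eq_1:
  assumes "b = 1" "n \<ge> 1"
  shows "(\<exists>x y. pell_nth_solution d n x y) \<and>
    (\<forall>x y. pell_nth_solution d n x y \<longrightarrow> real_of_int x / real_of_int y =
      cfrac_fin (a - 1) (concat (replicate (n - 1) [1, 2 * a - 2]) @ [1]))"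
proof (rule pell_nth_solution_ratio[OF pell_fundamental_eq_1[OF \<open>b = 1\<close>] _ _ \<open>n \<ge> 1\<close>])
  fix n :: nat
  let ?R = "\<lambda>n. cfrac_fin (a - 1) (concat (replicate (n - 1) [1, 2 * a - 2]) @ [1])"
  assume n: "n \<ge> 1" and pos: "?R n > 0"
  define r A where "r = ?R n" and "A = real_of_int a"
  have A: "A \<ge> 2" using a by (simp add: A_def)
  have r: "r > 0" using pos by (simp only: r_def)
  have tail: "cfrac_fin (2 * a - 2) (concat (replicate (n - 1) [1, 2 * a - 2]) @ [1]) = r + A - 1"
    using cfrac_fin_add_left[of "a - 1" "a - 1"] by (simp add: r_def A_def)
  have "concat (replicate (Suc n - 1) [1, 2 * a - 2]) @ [1] =
      1 # (2 * a - 2) # (concat (replicate (n - 1) [1, 2 * a - 2]) @ [1])"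
    using n by (cases n) simp_all
  then have "?R (Suc n) = A - 1 + 1 / (1 + 1 / (r + A - 1))"
    by (simp only: cfrac_fin.simps tail) (simp add: A_def)
  \<comment> \<open>As \<open>A * A - 1\<close> is \<open>d\<close>, this is the recurrence for the
    fundamental solution \<open>(a, 1)\<close>.\<close>
  also have "\<dots> = (A * r + (A * A - 1)) / (A + r)"
  proof -
    have "1 + 1 / (r + A - 1) = (r + A) / (r + A - 1)" using A r by (simp add: field_simps)
    then show ?thesis using A r by (simp add: field_simps)
  qed
  finally show "?R (Suc n) = (real_of_int a * ?R n + real_of_int (d * 1)) /
      (real_of_int a + real_of_int 1 * ?R n)"
    unfolding r_def[symmetric] using \<open>b = 1\<close> by (simp add: A_def d power2_eq_square)
\<comment> \<open>What remains is the initial value: \<open>[a - 1; 1]\<close> equals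
  \<open>a / 1\<close>.\<close>
qed simp

text \<open>The fraction ends in a full period without its last quotient. For \<open>n = 1\<close>
  this gives \<open>a*b - 1/(2*a)\<close>, which is \<open>x1 / y1\<close>; ending in a single
  \<open>1\<close> would give \<open>a*b\<close> instead.\<close>

lemma pell_nth_ratio_gt_1:
  assumes "b > 1" "n \<ge> 1"
  shows "(\<exists>x y. pell_nth_solution d n x y) \<and>
    (\<forall>x y. pell_nth_solution d n x y \<longrightarrow> real_of_int x / real_of_int y =
      cfrac_fin (a * b - 1) (concat (replicate (n - 1) [1, 2 * a - 2, 1, 2 * a * b - 2])
        @ [1, 2 * a - 2, 1]))"
proof (rule pell_nth_solution_ratio[OF pell_fundamental_gt_1[OF \<open>b > 1\<close>] _ _ \<open>n \<ge> 1\<close>])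
  let ?cs = "\<lambda>n. concat (replicate (n - 1) [1, 2 * a - 2, 1, 2 * a * b - 2]) @ [1, 2 * a - 2, 1]"
  let ?R = "\<lambda>n. cfrac_fin (a * b - 1) (?cs n)"
  show "?R 1 = real_of_int (2 * a\<^sup>2 * b - 1) / real_of_int (2 * a)"
    using a by (simp add: field_simps power2_eq_square)
  fix n :: nat
  assume n: "n \<ge> 1" and pos: "?R n > 0"
  define r A B where "r = ?R n" and "A = real_of_int a" and "B = real_of_int b"
  have A: "A \<ge> 2" and B: "B \<ge> 1" using a b by (simp_all add: A_def B_def)
  have r: "r > 0" using pos by (simp only: r_def)
  \<comment> \<open>\<open>w\<close> is the value of the tail that begins with the quotient
    \<open>2*a*b - 2\<close>, as \<open>tail\<close> confirms.\<close>
  define w where "w = r + A * B - 1"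
  have "A * B \<ge> 2 * 1" using A B by (intro mult_mono) auto
  then have w: "w > 0" using r by (simp add: w_def)
  have tail: "cfrac_fin (2 * a * b - 2) (?cs n) = w"
    using cfrac_fin_add_left[of "a * b - 1" "a * b - 1"]
    by (simp add: r_def A_def B_def w_def algebra_simps)
  have "?cs (Suc n) = 1 # (2 * a - 2) # 1 # (2 * a * b - 2) # ?cs n"
    using n by (cases n) simp_all
  then have "?R (Suc n) = A * B - 1 + 1 / (1 + 1 / (2 * A - 2 + 1 / (1 + 1 / w)))"
    by (simp only: cfrac_fin.simps tail) (simp add: A_def B_def)
  also have "\<dots> = A * B - (w + 1) / (2 * A * w + 2 * A - 1)"
  proof -
    have Aw: "A * w \<ge> 2 * w" using A w by (intro mult_right_mono) auto
    \<comment> \<open>Clearing fractions from the inside gives first \<open>?N / (w + 1)\<close> and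
      then \<open>?M / ?N\<close>. Since \<open>?M = ?N + w + 1\<close>, the last reciprocal is
      \<open>1 - (w + 1) / ?M\<close>.\<close>
    let ?N = "(2 * A - 1) * w + 2 * A - 2" and ?M = "2 * A * w + 2 * A - 1"
    have "?N = 2 * (A * w) - w + 2 * A - 2" by (simp add: algebra_simps)
    then have N: "?N > 0" using Aw A w by linarith
    have "?M = 2 * (A * w) + 2 * A - 1" by simp
    then have M: "?M > 0" using Aw A w by linarith
    have "1 / (1 + 1 / w) = w / (w + 1)" using w by (simp add: field_simps)
    then have "2 * A - 2 + 1 / (1 + 1 / w) = ?N / (w + 1)" using w by (simp add: field_simps)
    then have "1 / (2 * A - 2 + 1 / (1 + 1 / w)) = (w + 1) / ?N" by simp
    then have "1 + 1 / (2 * A - 2 + 1 / (1 + 1 / w)) = ?M / ?N" using N by (simp add: field_simps)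
    then have "1 / (1 + 1 / (2 * A - 2 + 1 / (1 + 1 / w))) = ?N / ?M" by simp
    moreover have "?N / ?M = 1 - (w + 1) / ?M" using M by (simp add: field_simps)
    ultimately show ?thesis by simp
  qed
  also have "\<dots> = ((2 * A * A * B - 1) * r + (A * A * B * B - B) * (2 * A)) /
      (2 * A * A * B - 1 + 2 * A * r)"
  proof -
    \<comment> \<open>In terms of \<open>r\<close>, the denominator \<open>?M\<close> becomes
      \<open>x1 + y1 * r\<close>, as the recurrence requires.\<close>
    have eq: "2 * A * w + 2 * A - 1 = 2 * A * A * B - 1 + 2 * A * r"
      by (simp add: w_def algebra_simps)
    have "2 * A * w > 0" using A w by simp
    then have "2 * A * A * B - 1 + 2 * A * r > 0" using A unfolding eq[symmetric] by linarith
    then show ?thesis unfolding eq by (simp add: w_def field_simps)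
  qed
  finally show "?R (Suc n) =
      (real_of_int (2 * a\<^sup>2 * b - 1) * ?R n + real_of_int (d * (2 * a))) /
      (real_of_int (2 * a\<^sup>2 * b - 1) + real_of_int (2 * a) * ?R n)"
    unfolding r_def[symmetric] by (simp add: A_def B_def d power2_eq_square mult_ac)
qed

end

theorem theorem4:
  fixes a b d :: int
  assumes "a \<ge> 2" and "b \<ge> 1"
    and "d = a\<^sup>2 * b\<^sup>2 - b"
  shows
    "has_cfrac (sqrt (real_of_int d))
       (if b = 1 then periodic_quotients (a - 1) [1, 2 * a - 2]
        else periodic_quotients (a * b - 1) [1, 2 * a - 2, 1, 2 * a * b - 2])
     \<and>
     (if b = 1 then pell_fundamental d a 1
      else pell_fundamental d (2 * a\<^sup>2 * b - 1) (2 * a))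
     \<and>
     (\<forall>n\<ge>1. (\<exists>x y. pell_nth_solution d n x y) \<and>
        (\<forall>x y. pell_nth_solution d n x y \<longrightarrow>
           real_of_int x / real_of_int y =
             (if b = 1
              then cfrac_fin (a - 1) (concat (replicate (n - 1) [1, 2 * a - 2]) @ [1])
              else cfrac_fin (a * b - 1)
                     (concat (replicate (n - 1) [1, 2 * a - 2, 1, 2 * a * b - 2])
                       @ [1, 2 * a - 2, 1]))))"
proof -
  interpret pell_parameters a b d by unfold_locales (fact assms)+
  show ?thesis
  proof (cases "b = 1")
    case True
    then show ?thesis using cfrac_eq_1 pell_fundamental_eq_1 pell_nth_ratio_eq_1 by simp
  next
    case False
    then have "b > 1" using b by simp
    with False show ?thesis
      using cfrac_general pell_fundamental_gt_1 pell_nth_ratio_gt_1 by simp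
  qed
qed

end
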